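(* Let $(R_n)_{n\ge1}$ be an ambient chain with limit $R_\infty$ as described in the context. Let $(\mathrm{cl}_n)_{n\ge1}$ and $\mathrm{cl}_\infty$ be closure operations on the $R_n$ and $R_\infty$ forming a consistent system such that $(\mathrm{cl}_n)_n$ is compatible with $\mathrm{Inc}$. Let $\mathcal A=(A_n)_{n\ge1}$ be an $\mathrm{Inc}$-invariant, $(\mathrm{cl}_n)$-closed chain whose limit $A_\infty=\bigcup_nA_n$ is $\mathrm{cl}_\infty$-closed. Consider: (a) $\mathcal A$ stabilizes and is eventually finitely generated; (b) $A_\infty$ is $\mathrm{Inc}$-equivariantly finitely generated, i.e. $A_\infty=(\mathrm{Inc}(G))^{\mathrm{cl}_\infty}$ for some finite $G\subseteq A_\infty$. Then (a) implies (b), and if $\mathcal A$ is eventually saturated (i.e. $A_n=A_\infty\cap R_n$ for all large $n$), then (a) and (b) are equivalent.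
   Context: The ambient chain is one of two types. Type 1: $K$ a field, $c\ge1$, $R_n=K[x_{i,j}: i\in[c], j\in[n]]$, $R_n\subseteq R_{n+1}$, $R_\infty=K[x_{i,j}:i\in[c],j\in\mathbb N]$. Type 2: $R_n\subseteq\mathbb R^n$, where $\mathbb R^m\subseteq\mathbb R^n$ via $v\mapsto(v,0,\dots,0)$, $R_m\subseteq R_n$ for $m\le n$, $R_\infty=\bigcup_nR_n$, and $\pi(R_m)\subseteq R_n$ for every injective $\pi:[m]\to[n]$. An injective $\pi:[m]\to[n]$ acts $R_m\to R_n$ by $\pi(\sum_kv_k\epsilon_k)=\sum_kv_k\epsilon_{\pi(k)}$ (type 2) or by the $K$-algebra homomorphism $x_{i,j}\mapsto x_{i,\pi(j)}$ (type 1). $\mathrm{Inc}$ is the monoid of strictly increasing maps $\mathbb N\to\mathbb N$ and $\mathrm{Inc}_{m,n}=\{\pi\in\mathrm{Inc}:\pi(m)\le n\}$; $\pi\in\mathrm{Inc}_{m,n}$ acts $R_m\to R_n$ via its restriction to $[m]$, and $\mathrm{Inc}$ acts on $R_\infty$ in the same way. A closure operation on $X$ is a map $A\mapsto A^{\mathrm{cl}}$ on subsets with $A\subseteq A^{\mathrm{cl}}$, $(A^{\mathrm{cl}})^{\mathrm{cl}}=A^{\mathrm{cl}}$, monotone; $A$ closed if $A^{\mathrm{cl}}=A$. Consistency: $(A\cap R_n)^{\mathrm{cl}_n}=A^{\mathrm{cl}_\infty}\cap R_n$ for all $n$ and $A\subseteq R_\infty$. Compatibility with $\mathrm{Inc}$: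 $\mathrm{Inc}_{m,n}(A^{\mathrm{cl}_m})\subseteq(\mathrm{Inc}_{m,n}(A))^{\mathrm{cl}_n}$ for all $n\ge m$, $A\subseteq R_m$. A chain $\mathcal A=(A_n)$ has $A_n\subseteq R_n$, $A_n\subseteq A_{n+1}$; $(\mathrm{cl}_n)$-closed if each $A_n$ is $\mathrm{cl}_n$-closed; $\mathrm{Inc}$-invariant if $(\mathrm{Inc}_{m,n}(A_m))^{\mathrm{cl}_n}\subseteq A_n$ for all $n\ge m$; stabilizes if there is $r$ with $(\mathrm{Inc}_{m,n}(A_m))^{\mathrm{cl}_n}=A_n$ for all $n\ge m\ge r$; eventually finitely generated if for all large $n$, $A_n=G_n^{\mathrm{cl}_n}$ for a finite $G_n\subseteq A_n$. *)

theory Defs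
  imports Complex_Main "HOL-Library.Poly_Mapping"
begin

text \<open>Indices are positive throughout: \<open>\<nat> = {1, 2, \<dots>}\<close> and \<open>[n] = {1..n}\<close>. Families indexed by
  \<open>n \<ge> 1\<close> are functions on \<open>nat\<close> whose value at \<open>0\<close> is never used.\<close>

text \<open>Polynomials in variables \<open>x\<^sub>i\<^sub>,\<^sub>j\<close>: a monomial is a finitely supported exponent function on
  the index pairs \<open>(i, j)\<close>, and a polynomial a finitely supported coefficient function on monomials.\<close>

type_synonym 'k mpoly = "(nat \<times> nat \<Rightarrow>\<^sub>0 nat) \<Rightarrow>\<^sub>0 'k"

definition const_poly :: "'k::zero \<Rightarrow> 'k mpoly" where
  "const_poly a = Poly_Mapping.single 0 a"

definition var_poly :: "nat \<times> nat \<Rightarrow> 'k::zero_neq_one mpoly" where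
  "var_poly v = Poly_Mapping.single (Poly_Mapping.single v 1) 1"

definition vars :: "'k::zero mpoly \<Rightarrow> (nat \<times> nat) set" where
  "vars p = (\<Union>t \<in> Poly_Mapping.keys p. Poly_Mapping.keys t)"

definition polys_in :: "(nat \<times> nat) set \<Rightarrow> 'k::zero mpoly set" where
  "polys_in V = {p. vars p \<subseteq> V}"

definition poly_chain :: "nat \<Rightarrow> nat \<Rightarrow> 'k::zero mpoly set" where
  "poly_chain c n = polys_in ({1..c} \<times> {1..n})"

definition poly_act :: "(nat \<Rightarrow> nat) \<Rightarrow> 'k::comm_ring_1 mpoly \<Rightarrow> 'k mpoly" where
  "poly_act \<pi> p = (\<Sum>t \<in> Poly_Mapping.keys p. const_poly (Poly_Mapping.lookup p t) *
     (\<Prod>(i, j) \<in> Poly_Mapping.keys t. var_poly (i, \<pi> j) ^ Poly_Mapping.lookup t (i, j)))"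

text \<open>All the \<open>\<real>\<^sup>n\<close> live inside the space of finitely supported sequences, so that the inclusions
  \<open>v \<mapsto> (v, 0, \<dots>, 0)\<close> become inclusions of sets.\<close>

definition real_space :: "nat \<Rightarrow> (nat \<Rightarrow>\<^sub>0 real) set" where
  "real_space n = {v. Poly_Mapping.keys v \<subseteq> {1..n}}"

definition real_act :: "(nat \<Rightarrow> nat) \<Rightarrow> (nat \<Rightarrow>\<^sub>0 real) \<Rightarrow> (nat \<Rightarrow>\<^sub>0 real)" where
  "real_act \<pi> v = (\<Sum>k \<in> Poly_Mapping.keys v. Poly_Mapping.single (\<pi> k) (Poly_Mapping.lookup v k))"

text \<open>An injective map \<open>[m] \<rightarrow> [n]\<close> is given by any extension to \<open>nat\<close>; on vectors supported in
  \<open>[m]\<close> the action does not depend on the extension.\<close>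

definition real_chain :: "(nat \<Rightarrow> (nat \<Rightarrow>\<^sub>0 real) set) \<Rightarrow> bool" where
  "real_chain R \<longleftrightarrow>
     (\<forall>n\<ge>1. R n \<subseteq> real_space n) \<and>
     (\<forall>m\<ge>1. \<forall>n\<ge>m. R m \<subseteq> R n) \<and>
     (\<forall>m\<ge>1. \<forall>n\<ge>1. \<forall>\<pi>. inj_on \<pi> {1..m} \<and> \<pi> ` {1..m} \<subseteq> {1..n} \<longrightarrow> real_act \<pi> ` R m \<subseteq> R n)"

definition limit :: "(nat \<Rightarrow> 'x set) \<Rightarrow> 'x set" where
  "limit R = (\<Union>n\<in>{1..}. R n)"

text \<open>The convention \<open>\<pi> 0 = 0\<close> makes these maps correspond bijectively to the strictly increasing
  self-maps of \<open>{1, 2, \<dots>}\<close>.\<close>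

definition Inc :: "(nat \<Rightarrow> nat) set" where
  "Inc = {\<pi>. strict_mono \<pi> \<and> \<pi> 0 = 0}"

definition Inc_mn :: "nat \<Rightarrow> nat \<Rightarrow> (nat \<Rightarrow> nat) set" where
  "Inc_mn m n = {\<pi> \<in> Inc. \<pi> m \<le> n}"

definition orbit :: "((nat \<Rightarrow> nat) \<Rightarrow> 'x \<Rightarrow> 'x) \<Rightarrow> (nat \<Rightarrow> nat) set \<Rightarrow> 'x set \<Rightarrow> 'x set" where
  "orbit act P A = {act \<pi> a | \<pi> a. \<pi> \<in> P \<and> a \<in> A}"

definition closure_operation :: "'x set \<Rightarrow> ('x set \<Rightarrow> 'x set) \<Rightarrow> bool" where
  "closure_operation X cl \<longleftrightarrow>
     (\<forall>A\<subseteq>X. cl A \<subseteq> X \<and> A \<subseteq> cl A \<and> cl (cl A) = cl A) \<and>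
     (\<forall>A B. A \<subseteq> B \<and> B \<subseteq> X \<longrightarrow> cl A \<subseteq> cl B)"

definition consistent ::
  "(nat \<Rightarrow> 'x set) \<Rightarrow> (nat \<Rightarrow> 'x set \<Rightarrow> 'x set) \<Rightarrow> ('x set \<Rightarrow> 'x set) \<Rightarrow> bool" where
  "consistent R cl cl_inf \<longleftrightarrow>
     (\<forall>n\<ge>1. \<forall>A\<subseteq>limit R. cl n (A \<inter> R n) = cl_inf A \<inter> R n)"

definition Inc_compatible ::
  "(nat \<Rightarrow> 'x set) \<Rightarrow> ((nat \<Rightarrow> nat) \<Rightarrow> 'x \<Rightarrow> 'x) \<Rightarrow> (nat \<Rightarrow> 'x set \<Rightarrow> 'x set) \<Rightarrow> bool" where
  "Inc_compatible R act cl \<longleftrightarrow>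
     (\<forall>m\<ge>1. \<forall>n\<ge>m. \<forall>A\<subseteq>R m. orbit act (Inc_mn m n) (cl m A) \<subseteq> cl n (orbit act (Inc_mn m n) A))"

definition is_chain :: "(nat \<Rightarrow> 'x set) \<Rightarrow> (nat \<Rightarrow> 'x set) \<Rightarrow> bool" where
  "is_chain R A \<longleftrightarrow> (\<forall>n\<ge>1. A n \<subseteq> R n \<and> A n \<subseteq> A (n + 1))"

definition closed_chain :: "(nat \<Rightarrow> 'x set \<Rightarrow> 'x set) \<Rightarrow> (nat \<Rightarrow> 'x set) \<Rightarrow> bool" where
  "closed_chain cl A \<longleftrightarrow> (\<forall>n\<ge>1. cl n (A n) = A n)"

definition Inc_invariant ::
  "((nat \<Rightarrow> nat) \<Rightarrow> 'x \<Rightarrow> 'x) \<Rightarrow> (nat \<Rightarrow> 'x set \<Rightarrow> 'x set) \<Rightarrow> (nat \<Rightarrow> 'x set) \<Rightarrow> bool" where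
  "Inc_invariant act cl A \<longleftrightarrow>
     (\<forall>m\<ge>1. \<forall>n\<ge>m. cl n (orbit act (Inc_mn m n) (A m)) \<subseteq> A n)"

definition stabilizes ::
  "((nat \<Rightarrow> nat) \<Rightarrow> 'x \<Rightarrow> 'x) \<Rightarrow> (nat \<Rightarrow> 'x set \<Rightarrow> 'x set) \<Rightarrow> (nat \<Rightarrow> 'x set) \<Rightarrow> bool" where
  "stabilizes act cl A \<longleftrightarrow>
     (\<exists>r\<ge>1. \<forall>m\<ge>r. \<forall>n\<ge>m. cl n (orbit act (Inc_mn m n) (A m)) = A n)"

definition eventually_finitely_generated ::
  "(nat \<Rightarrow> 'x set \<Rightarrow> 'x set) \<Rightarrow> (nat \<Rightarrow> 'x set) \<Rightarrow> bool" where
  "eventually_finitely_generated cl A \<longleftrightarrow>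
     (\<forall>\<^sub>F n in sequentially. \<exists>G. finite G \<and> G \<subseteq> A n \<and> A n = cl n G)"

definition eventually_saturated :: "(nat \<Rightarrow> 'x set) \<Rightarrow> (nat \<Rightarrow> 'x set) \<Rightarrow> bool" where
  "eventually_saturated R A \<longleftrightarrow> (\<forall>\<^sub>F n in sequentially. A n = limit A \<inter> R n)"

definition Inc_finitely_generated ::
  "((nat \<Rightarrow> nat) \<Rightarrow> 'x \<Rightarrow> 'x) \<Rightarrow> ('x set \<Rightarrow> 'x set) \<Rightarrow> 'x set \<Rightarrow> bool" where
  "Inc_finitely_generated act cl_inf S \<longleftrightarrow>
     (\<exists>G. finite G \<and> G \<subseteq> S \<and> S = cl_inf (orbit act Inc G))"

text \<open>The limit of the polynomial chain is the full polynomial ring.\<close>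

lemma limit_poly_chain: "limit (poly_chain c) = (polys_in ({1..c} \<times> {1..}) :: 'k::zero mpoly set)"
proof
  show "limit (poly_chain c) \<subseteq> (polys_in ({1..c} \<times> {1..}) :: 'k mpoly set)"
    by (fastforce simp: limit_def poly_chain_def polys_in_def)
  show "(polys_in ({1..c} \<times> {1..}) :: 'k mpoly set) \<subseteq> limit (poly_chain c)"
  proof
    fix p :: "'k mpoly" assume p: "p \<in> polys_in ({1..c} \<times> {1..})"
    have "finite (snd ` vars p)" by (simp add: vars_def)
    then obtain N where "\<forall>j \<in> snd ` vars p. j \<le> N"
      using finite_nat_set_iff_bounded_le by blast
    then have "vars p \<subseteq> {1..c} \<times> {1..Suc N}"
      using p by (fastforce simp: polys_in_def)
    then show "p \<in> limit (poly_chain c)"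
      by (auto simp: limit_def poly_chain_def polys_in_def intro!: bexI[of _ "Suc N"])
  qed
qed

text \<open>\<open>poly_act \<pi>\<close> is the algebra homomorphism sending \<open>x\<^sub>i\<^sub>,\<^sub>j\<close> to \<open>x\<^sub>i\<^sub>,\<^sub>\<pi>\<^sub>j\<close>.\<close>

lemma poly_act_const [simp]: "poly_act \<pi> (const_poly a) = const_poly a"
  by (simp add: poly_act_def const_poly_def mult_single)

lemma poly_act_var [simp]: "poly_act \<pi> (var_poly (i, j)) = var_poly (i, \<pi> j)"
  by (simp add: poly_act_def var_poly_def const_poly_def mult_single)

lemma poly_act_add: "poly_act \<pi> (p + q) = poly_act \<pi> p + poly_act \<pi> (q :: 'k::comm_ring_1 mpoly)"
  unfolding poly_act_def
  by (rule setsum_keys_plus_distrib)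
     (auto simp: const_poly_def single_add distrib_right)

lemma poly_act_sum: "finite I \<Longrightarrow> poly_act \<pi> (sum f I) = (\<Sum>i\<in>I. poly_act \<pi> (f i))"
  by (induction I rule: finite_induct) (simp_all add: poly_act_add, simp add: poly_act_def)

lemma poly_act_single: "poly_act \<pi> (Poly_Mapping.single t a) = const_poly a *
    (\<Prod>(i, j) \<in> Poly_Mapping.keys t. var_poly (i, \<pi> j) ^ Poly_Mapping.lookup t (i, j))"
  by (simp add: poly_act_def const_poly_def)

lemma poly_act_mult_single:
  "poly_act \<pi> (Poly_Mapping.single s a * Poly_Mapping.single t b) =
     poly_act \<pi> (Poly_Mapping.single s a) * poly_act \<pi> (Poly_Mapping.single t b)"
proof -
  define K where "K = Poly_Mapping.keys s \<union> Poly_Mapping.keys t"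
  let ?M = "\<lambda>u. \<Prod>(i, j) \<in> Poly_Mapping.keys u. (var_poly (i, \<pi> j) :: 'a mpoly) ^ Poly_Mapping.lookup u (i, j)"
  have *: "?M u = (\<Prod>(i, j) \<in> K. var_poly (i, \<pi> j) ^ Poly_Mapping.lookup u (i, j))"
    if "Poly_Mapping.keys u \<subseteq> K" for u
    using that by (intro prod.mono_neutral_left) (auto simp: K_def in_keys_iff)
  have "Poly_Mapping.keys (s + t) \<subseteq> K" "Poly_Mapping.keys s \<subseteq> K" "Poly_Mapping.keys t \<subseteq> K"
    unfolding K_def by (rule keys_add) auto
  note eqs = this[THEN *]
  have "?M (s + t) = ?M s * ?M t"
    unfolding eqs prod.distrib[symmetric] by (rule prod.cong) (auto simp: lookup_add power_add)
  moreover have "const_poly (a * b) = const_poly a * const_poly b"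
    by (simp add: const_poly_def mult_single)
  ultimately show ?thesis
    by (simp add: mult_single poly_act_single ac_simps)
qed

lemma mpoly_eq_sum_single:
  "p = (\<Sum>t \<in> Poly_Mapping.keys p. Poly_Mapping.single t (Poly_Mapping.lookup p t))"
  by (rule poly_mapping_eqI)
     (auto simp: lookup_sum lookup_single when_def in_keys_iff sum.delta cong: if_cong)

lemma poly_act_mult: "poly_act \<pi> (p * q) = poly_act \<pi> p * poly_act \<pi> (q :: 'k::comm_ring_1 mpoly)"
  by (subst (1 2) mpoly_eq_sum_single[of p], subst (1 2) mpoly_eq_sum_single[of q])
     (simp add: sum_product poly_act_sum poly_act_mult_single)

end

(* Stabilization and finite generation at a late stage m give an equivariant generating set, because
  compatibility moves the closure past the orbit.  Conversely, if the finite set G generates the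
  limit, consistency and saturation give A n = cl n (Inc(G) \<inter> R n).  An element act \<pi> g of R n
  need not lie in the (m, n)-orbit of g; instead \<pi> = \<sigma> \<circ> \<tau> with
  \<tau> = max id (\<pi> - (n - m)) and \<sigma> = min \<pi> (id + (n - m)), where act \<tau> g lies in A m and
  \<sigma> belongs to Inc_mn m n. *)

theory Submission
  imports Defs "HOL-Library.FuncSet"
begin

section \<open>Strictly increasing maps\<close>

lemma Inc_inj: "\<pi> \<in> Inc \<Longrightarrow> inj \<pi>"
  by (simp add: Inc_def strict_mono_imp_inj_on)

lemma Inc_less: "\<lbrakk>\<pi> \<in> Inc; i < j\<rbrakk> \<Longrightarrow> \<pi> i < \<pi> j"
  by (simp add: Inc_def strict_mono_less)

lemma Inc_le: "\<lbrakk>\<pi> \<in> Inc; i \<le> j\<rbrakk> \<Longrightarrow> \<pi> i \<le> \<pi> j"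
  by (simp add: Inc_def strict_mono_less_eq)

lemma Inc_ge: "\<pi> \<in> Inc \<Longrightarrow> n \<le> \<pi> n"
  by (simp add: Inc_def strict_mono_imp_increasing)

lemma Inc_pos: "\<lbrakk>\<pi> \<in> Inc; 1 \<le> n\<rbrakk> \<Longrightarrow> 1 \<le> \<pi> n"
  using Inc_ge order_trans by blast

text \<open>Each step raises the value by at least one, so the displacement
  \<open>\<pi> i - i\<close> never drops. The additive form avoids truncated subtraction.\<close>

lemma Inc_gap_mono:
  assumes "\<pi> \<in> Inc" "i \<le> j"
  shows "\<pi> i + j \<le> \<pi> j + i"
  using assms(2)
proof (induction j rule: dec_induct)
  case (step k)
  then show ?case using Inc_less[OF assms(1), of k "Suc k"] by simp
qed simp

text \<open>\<open>\<sigma>\<close> carries at most \<open>d\<close> of each displacement and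
  \<open>\<tau>\<close> the excess. For \<open>d = n - m\<close> with \<open>m \<le> n\<close>, the
  bound on \<open>\<sigma>\<close> places it in \<open>Inc_mn m n\<close>, and the formula for
  \<open>\<tau>\<close> controls where supports go.\<close>

lemma Inc_factorization:
  assumes "\<pi> \<in> Inc"
  obtains \<sigma> \<tau> where "\<sigma> \<in> Inc" "\<tau> \<in> Inc" "\<pi> = \<sigma> \<circ> \<tau>"
    "\<And>i. \<sigma> i \<le> i + d" "\<And>i. \<tau> i = max i (\<pi> i - d)"
proof
  define \<sigma> \<tau> where "\<sigma> = (\<lambda>i. min (\<pi> i) (i + d))" and "\<tau> = (\<lambda>i. max i (\<pi> i - d))"
  have [simp]: "\<pi> 0 = 0" using assms by (simp add: Inc_def)
  have step: "\<pi> i < \<pi> (Suc i)" for i using assms by (simp add: Inc_less)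
  have "\<sigma> i < \<sigma> (Suc i)" for i
    using step[of i] by (auto simp: \<sigma>_def min_def)
  then show "\<sigma> \<in> Inc" by (simp add: Inc_def strict_mono_Suc_iff) (simp add: \<sigma>_def)
  \<comment> \<open>Truncation of \<open>\<pi> i - d\<close> at 0 is harmless: this term exceeds
    \<open>i\<close> only when it is positive, and there it grows strictly with
    \<open>\<pi>\<close>.\<close>
  have "\<tau> i < \<tau> (Suc i)" for i
    using step[of i] by (auto simp: \<tau>_def max_def)
  then show "\<tau> \<in> Inc" by (simp add: Inc_def strict_mono_Suc_iff) (simp add: \<tau>_def)
  show "\<pi> = \<sigma> \<circ> \<tau>"
  proof
    fix j
    show "\<pi> j = (\<sigma> \<circ> \<tau>) j"
    proof (cases "\<pi> j \<le> j + d")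
      case True
      then show ?thesis by (simp add: \<sigma>_def \<tau>_def)
    next
      case False
      \<comment> \<open>Here \<open>\<tau> j = \<pi> j - d > j\<close>. The displacement of
        \<open>\<pi>\<close> at this later point is at least that at \<open>j\<close>, hence above
        \<open>d\<close>, so \<open>\<sigma>\<close> adds exactly \<open>d\<close> and returns
        \<open>\<pi> j\<close>.\<close>
      then have "\<pi> j + (\<pi> j - d) \<le> \<pi> (\<pi> j - d) + j"
        using assms by (intro Inc_gap_mono) auto
      with False show ?thesis by (auto simp: \<sigma>_def \<tau>_def max_def min_def)
    qed
  qed
qed auto

text \<open>In a finite \<open>X\<close> the complements of \<open>S\<close> and of its injective
  image have equal size, so a bijection between them completes \<open>f\<close>. This serves the
  real chain, whose axiom speaks of injections on a whole interval while only values on a support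
  are controlled.\<close>

lemma inj_on_extend_subset:
  assumes "finite X" "S \<subseteq> X" "inj_on f S" "f ` S \<subseteq> X"
  obtains g where "inj_on g X" "g ` X \<subseteq> X" "\<And>x. x \<in> S \<Longrightarrow> g x = f x"
proof -
  have fin: "finite S" using assms finite_subset by blast
  have "card (X - S) = card (X - f ` S)"
    using assms fin by (simp add: card_Diff_subset card_image)
  then obtain h where h: "bij_betw h (X - S) (X - f ` S)"
    using assms(1) by (meson bij_betw_iff_card finite_Diff)
  define g where "g x = (if x \<in> S then f x else h x)" for x
  have "bij_betw g S (f ` S)"
    using inj_on_imp_bij_betw[OF assms(3)] bij_betw_cong[of S g f] by (simp add: g_def)
  moreover have "bij_betw g (X - S) (X - f ` S)"
    using h bij_betw_cong[of "X - S" g h] by (simp add: g_def)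
  ultimately have "bij_betw g (S \<union> (X - S)) (f ` S \<union> (X - f ` S))"
    by (rule bij_betw_combine) blast
  then have "bij_betw g X X"
    using assms by (simp add: Un_absorb1)
  then show thesis
    by (intro that[of g]) (auto simp: bij_betw_def g_def)
qed

section \<open>Chains with an action of increasing maps\<close>

lemma orbit_mono: "A \<subseteq> B \<Longrightarrow> orbit act P A \<subseteq> orbit act P B"
  unfolding orbit_def by blast

text \<open>Common interface of the two types; \<open>supp x\<close> is the set of column indices
  occurring in \<open>x\<close>. \<open>act_stays\<close> restricts \<open>\<pi>\<close> only on the
  support, so \<open>act \<tau> g\<close> can lie in \<open>R m\<close> even when
  \<open>\<tau> m > m\<close>.\<close>

locale ambient_chain =
  fixes R :: "nat \<Rightarrow> 'x set"
    and act :: "(nat \<Rightarrow> nat) \<Rightarrow> 'x \<Rightarrow> 'x"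
    and supp :: "'x \<Rightarrow> nat set"
  assumes R_mono: "\<lbrakk>1 \<le> m; m \<le> n\<rbrakk> \<Longrightarrow> R m \<subseteq> R n"
    and act_comp: "\<lbrakk>\<sigma> \<in> Inc; \<tau> \<in> Inc\<rbrakk> \<Longrightarrow> act \<sigma> (act \<tau> x) = act (\<sigma> \<circ> \<tau>) x"
    and act_cong: "(\<And>j. j \<in> supp x \<Longrightarrow> \<pi> j = \<rho> j) \<Longrightarrow> act \<pi> x = act \<rho> x"
    and supp_act: "\<pi> \<in> Inc \<Longrightarrow> supp (act \<pi> x) = \<pi> ` supp x"
    and finite_supp: "finite (supp x)"
    and supp_R: "\<lbrakk>1 \<le> n; x \<in> R n\<rbrakk> \<Longrightarrow> supp x \<subseteq> {1..n}"
    and act_stays: "\<lbrakk>1 \<le> n; x \<in> R n; \<pi> \<in> Inc; \<pi> ` supp x \<subseteq> {1..n}\<rbrakk> \<Longrightarrow> act \<pi> x \<in> R n"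
begin

lemma act_in_R:
  assumes "1 \<le> m" "x \<in> R m" "\<pi> \<in> Inc_mn m n"
  shows "act \<pi> x \<in> R n"
proof -
  have \<pi>: "\<pi> \<in> Inc" "\<pi> m \<le> n" using assms(3) by (auto simp: Inc_mn_def)
  then have "m \<le> n" using Inc_ge order_trans by blast
  moreover have "\<pi> j \<in> {1..n}" if "j \<in> supp x" for j
  proof -
    have "1 \<le> j" "j \<le> m" using supp_R[OF assms(1,2)] that by auto
    then show ?thesis
      using Inc_pos[OF \<pi>(1)] Inc_le[OF \<pi>(1), of j m] \<pi>(2) by auto
  qed
  ultimately show ?thesis
    using assms R_mono[of m n] \<pi>(1) by (intro act_stays) auto
qed

lemma orbit_subset_R: "\<lbrakk>1 \<le> m; A \<subseteq> R m\<rbrakk> \<Longrightarrow> orbit act (Inc_mn m n) A \<subseteq> R n"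
  by (auto simp: orbit_def intro: act_in_R)

text \<open>\<open>act \<pi> g\<close> depends only on \<open>\<pi>\<close> restricted to the finite
  set \<open>supp g\<close>, and membership in \<open>R n\<close> forces these values into
  \<open>{1..n}\<close>. Extensional functions have fixed values off the support, so only finitely
  many remain.\<close>

lemma finite_orbit_Int_R:
  assumes "finite G" "1 \<le> n"
  shows "finite (orbit act Inc G \<inter> R n)"
proof (rule finite_subset)
  show "orbit act Inc G \<inter> R n \<subseteq> (\<Union>g\<in>G. (\<lambda>\<pi>. act \<pi> g) ` (supp g \<rightarrow>\<^sub>E {1..n}))"
  proof
    fix x assume x: "x \<in> orbit act Inc G \<inter> R n"
    then obtain \<pi> g where \<pi>: "\<pi> \<in> Inc" "g \<in> G" "x = act \<pi> g"
      by (auto simp: orbit_def)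
    then have "\<pi> ` supp g \<subseteq> {1..n}"
      using x assms(2) supp_R[of n x] by (simp add: supp_act)
    then have "restrict \<pi> (supp g) \<in> supp g \<rightarrow>\<^sub>E {1..n}" by auto
    moreover have "x = act (restrict \<pi> (supp g)) g"
      using \<pi>(3) act_cong[of g "restrict \<pi> (supp g)" \<pi>] by simp
    ultimately show "x \<in> (\<Union>g\<in>G. (\<lambda>\<pi>. act \<pi> g) ` (supp g \<rightarrow>\<^sub>E {1..n}))"
      using \<pi>(2) by blast
  qed
  show "finite (\<Union>g\<in>G. (\<lambda>\<pi>. act \<pi> g) ` (supp g \<rightarrow>\<^sub>E {1..n}))"
    using assms(1) finite_supp by (intro finite_UN_I finite_imageI finite_PiE) auto
qed

text \<open>The combinatorial core of stabilization: an orbit element in \<open>R n\<close> is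
  reached through one already in \<open>R m\<close>, without taking any closure.\<close>

lemma orbit_Int_R_subset:
  assumes "1 \<le> m" "m \<le> n" "G \<subseteq> R m"
  shows "orbit act Inc G \<inter> R n \<subseteq> orbit act (Inc_mn m n) (orbit act Inc G \<inter> R m)"
proof
  fix x assume x: "x \<in> orbit act Inc G \<inter> R n"
  then obtain \<pi> g where \<pi>: "\<pi> \<in> Inc" "g \<in> G" "x = act \<pi> g"
    by (auto simp: orbit_def)
  obtain \<sigma> \<tau> where \<sigma>\<tau>: "\<sigma> \<in> Inc" "\<tau> \<in> Inc" "\<pi> = \<sigma> \<circ> \<tau>"
    "\<And>i. \<sigma> i \<le> i + (n - m)" "\<And>i. \<tau> i = max i (\<pi> i - (n - m))"
    using Inc_factorization[OF \<pi>(1), of "n - m"] by metis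
  have g: "g \<in> R m" using assms \<pi>(2) by auto
  \<comment> \<open>Both arguments of the maximum are at most \<open>m\<close>:
    \<open>j \<le> m\<close> since \<open>g\<close> lies in \<open>R m\<close>, and
    \<open>\<pi> j \<le> n\<close> since \<open>\<pi> j\<close> belongs to the support of
    \<open>x\<close>.\<close>
  have "\<tau> j \<in> {1..m}" if "j \<in> supp g" for j
  proof -
    have "j \<in> {1..m}" using supp_R[OF assms(1) g] that by auto
    moreover have "\<pi> ` supp g \<subseteq> {1..n}"
      using x assms supp_R[of n x] \<pi> by (simp add: supp_act)
    then have "\<pi> j \<le> n" using that by auto
    ultimately show ?thesis using assms(2) by (auto simp: \<sigma>\<tau>(5) le_max_iff_disj)
  qed
  then have "act \<tau> g \<in> R m" using assms g \<sigma>\<tau>(2) by (intro act_stays) auto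
  moreover have "\<sigma> \<in> Inc_mn m n" using \<sigma>\<tau>(1) \<sigma>\<tau>(4)[of m] assms(2) by (simp add: Inc_mn_def)
  moreover have "x = act \<sigma> (act \<tau> g)" using \<pi>(3) \<sigma>\<tau>(1-3) by (simp add: act_comp)
  ultimately show "x \<in> orbit act (Inc_mn m n) (orbit act Inc G \<inter> R m)"
    using \<sigma>\<tau>(2) \<pi>(2) unfolding orbit_def by blast
qed

end

section \<open>Closed invariant chains and the two implications\<close>

locale invariant_closed_chain = ambient_chain +
  fixes cl :: "nat \<Rightarrow> 'a set \<Rightarrow> 'a set" and cl_inf :: "'a set \<Rightarrow> 'a set" and A :: "nat \<Rightarrow> 'a set"
  assumes closure: "\<And>n. 1 \<le> n \<Longrightarrow> closure_operation (R n) (cl n)"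
    and closure_inf: "closure_operation (limit R) cl_inf"
    and consistent: "consistent R cl cl_inf"
    and compatible: "Inc_compatible R act cl"
    and chain: "is_chain R A"
    and invariant: "Inc_invariant act cl A"
    and closed_inf: "cl_inf (limit A) = limit A"
begin

lemma A_subset_R: "1 \<le> n \<Longrightarrow> A n \<subseteq> R n"
  using chain by (simp add: is_chain_def)

lemma A_mono:
  assumes "1 \<le> m" "m \<le> n"
  shows "A m \<subseteq> A n"
  using assms(2)
proof (induction n rule: dec_induct)
  case (step k)
  have "A k \<subseteq> A (Suc k)"
    using chain assms(1) step.hyps(1) by (simp add: is_chain_def)
  then show ?case using step.IH by blast
qed simp

lemma A_subset_limit: "1 \<le> n \<Longrightarrow> A n \<subseteq> limit A"
  by (auto simp: limit_def)

lemma limit_A_subset: "limit A \<subseteq> limit R"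
  using A_subset_R unfolding limit_def by fastforce

lemma cl_mono: "\<lbrakk>1 \<le> n; S \<subseteq> T; T \<subseteq> R n\<rbrakk> \<Longrightarrow> cl n S \<subseteq> cl n T"
  using closure[of n] by (simp add: closure_operation_def)

lemma cl_extensive: "\<lbrakk>1 \<le> n; S \<subseteq> R n\<rbrakk> \<Longrightarrow> S \<subseteq> cl n S"
  using closure[of n] by (simp add: closure_operation_def)

lemma cl_subset_R: "\<lbrakk>1 \<le> n; S \<subseteq> R n\<rbrakk> \<Longrightarrow> cl n S \<subseteq> R n"
  using closure[of n] by (simp add: closure_operation_def)

lemma cl_idem: "\<lbrakk>1 \<le> n; S \<subseteq> R n\<rbrakk> \<Longrightarrow> cl n (cl n S) = cl n S"
  using closure[of n] by (simp add: closure_operation_def)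

lemma cl_inf_mono: "\<lbrakk>S \<subseteq> T; T \<subseteq> limit R\<rbrakk> \<Longrightarrow> cl_inf S \<subseteq> cl_inf T"
  using closure_inf by (simp add: closure_operation_def)

lemma cl_Int_R: "\<lbrakk>1 \<le> n; S \<subseteq> limit R\<rbrakk> \<Longrightarrow> cl n (S \<inter> R n) = cl_inf S \<inter> R n"
  using consistent by (simp add: consistent_def)

lemma cl_orbit_subset: "\<lbrakk>1 \<le> m; m \<le> n\<rbrakk> \<Longrightarrow> cl n (orbit act (Inc_mn m n) (A m)) \<subseteq> A n"
  using invariant by (simp add: Inc_invariant_def)

lemma finite_subset_stage:
  assumes "finite G" "G \<subseteq> limit A"
  obtains m where "1 \<le> m" "G \<subseteq> A m"
proof -
  have "\<exists>m\<ge>1. G \<subseteq> A m"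
    using assms
  proof (induction G rule: finite_induct)
    case (insert x F)
    then obtain m k where "1 \<le> m" "F \<subseteq> A m" "1 \<le> k" "x \<in> A k"
      by (auto simp: limit_def)
    then have "insert x F \<subseteq> A (max m k)"
      using A_mono[of m "max m k"] A_mono[of k "max m k"] by auto
    then show ?case using \<open>1 \<le> m\<close> by (intro exI[of _ "max m k"]) auto
  qed auto
  then show thesis using that by blast
qed

lemma orbit_subset_limit:
  assumes "G \<subseteq> limit A"
  shows "orbit act Inc G \<subseteq> limit A"
proof
  fix x assume "x \<in> orbit act Inc G"
  then obtain \<pi> g where \<pi>: "\<pi> \<in> Inc" "g \<in> G" "x = act \<pi> g" by (auto simp: orbit_def)
  obtain m where m: "1 \<le> m" "g \<in> A m" using assms \<pi>(2) by (auto simp: limit_def)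
  have n: "m \<le> \<pi> m" "1 \<le> \<pi> m" using Inc_ge[OF \<pi>(1)] Inc_pos[OF \<pi>(1)] m(1) by auto
  \<comment> \<open>\<open>\<pi> m\<close> is the least stage \<open>n\<close> with
    \<open>\<pi> \<in> Inc_mn m n\<close>.\<close>
  have "x \<in> orbit act (Inc_mn m (\<pi> m)) (A m)"
    using \<pi> m by (auto simp: orbit_def Inc_mn_def)
  also have "\<dots> \<subseteq> cl (\<pi> m) (orbit act (Inc_mn m (\<pi> m)) (A m))"
    using m(1) n(2) by (intro cl_extensive orbit_subset_R A_subset_R)
  also have "\<dots> \<subseteq> A (\<pi> m)" using m(1) n(1) by (rule cl_orbit_subset)
  also have "\<dots> \<subseteq> limit A" using n(2) by (rule A_subset_limit)
  finally show "x \<in> limit A" .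
qed

lemma Inc_finitely_generated_if_stable:
  assumes "stabilizes act cl A" "eventually_finitely_generated cl A"
  shows "Inc_finitely_generated act cl_inf (limit A)"
proof -
  obtain r where r: "1 \<le> r"
    "\<And>m n. \<lbrakk>r \<le> m; m \<le> n\<rbrakk> \<Longrightarrow> cl n (orbit act (Inc_mn m n) (A m)) = A n"
    using assms(1) unfolding stabilizes_def by blast
  obtain N where N: "\<And>n. N \<le> n \<Longrightarrow> \<exists>G. finite G \<and> G \<subseteq> A n \<and> A n = cl n G"
    using assms(2) unfolding eventually_finitely_generated_def eventually_sequentially by blast
  define m where "m = max r N"
  have m: "1 \<le> m" "r \<le> m" "N \<le> m" using r(1) by (auto simp: m_def)
  obtain G where G: "finite G" "G \<subseteq> A m" "A m = cl m G" using N[OF m(3)] by blast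
  have GR: "G \<subseteq> R m" using G(2) A_subset_R[OF m(1)] by blast
  have orb: "orbit act Inc G \<subseteq> limit A"
    using G(2) A_subset_limit[OF m(1)] by (intro orbit_subset_limit) blast
  then have orbR: "orbit act Inc G \<subseteq> limit R" using limit_A_subset by blast
  \<comment> \<open>Stabilization writes \<open>A n\<close> as the closure of the orbit of
    \<open>A m = cl m G\<close>. Compatibility and idempotence bring this inside \<open>cl n\<close>
    of the orbit of \<open>G\<close>, and consistency places that inside
    \<open>cl_inf (orbit act Inc G)\<close>.\<close>
  have late: "A n \<subseteq> cl_inf (orbit act Inc G)" if n: "m \<le> n" for n
  proof -
    have n1: "1 \<le> n" using m(1) n by simp
    let ?O = "orbit act (Inc_mn m n) G"
    have OR: "?O \<subseteq> R n" using m(1) GR by (rule orbit_subset_R)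
    have "orbit act (Inc_mn m n) (cl m G) \<subseteq> cl n ?O"
      using compatible m(1) n GR by (auto simp: Inc_compatible_def)
    then have "cl n (orbit act (Inc_mn m n) (A m)) \<subseteq> cl n (cl n ?O)"
      using n1 OR G(3) by (intro cl_mono cl_subset_R) auto
    moreover have "?O \<subseteq> orbit act Inc G \<inter> R n"
      using OR by (auto simp: orbit_def Inc_mn_def)
    then have "cl n ?O \<subseteq> cl n (orbit act Inc G \<inter> R n)"
      using n1 by (intro cl_mono) auto
    ultimately show ?thesis
      using r(2)[OF m(2) n] cl_idem[OF n1 OR] cl_Int_R[OF n1 orbR] by auto
  qed
  have "limit A \<subseteq> cl_inf (orbit act Inc G)"
  proof
    fix x assume "x \<in> limit A"
    then obtain k where "1 \<le> k" "x \<in> A k" by (auto simp: limit_def)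
    then have "x \<in> A (max k m)" using A_mono[of k "max k m"] by auto
    then show "x \<in> cl_inf (orbit act Inc G)" using late[of "max k m"] by auto
  qed
  moreover have "cl_inf (orbit act Inc G) \<subseteq> limit A"
    using cl_inf_mono[OF orb limit_A_subset] closed_inf by simp
  ultimately show ?thesis
    using G(1,2) A_subset_limit[OF m(1)] unfolding Inc_finitely_generated_def by blast
qed

lemma stable_if_Inc_finitely_generated:
  assumes "eventually_saturated R A" "Inc_finitely_generated act cl_inf (limit A)"
  shows "stabilizes act cl A \<and> eventually_finitely_generated cl A"
proof -
  obtain G where G: "finite G" "G \<subseteq> limit A" "limit A = cl_inf (orbit act Inc G)"
    using assms(2) unfolding Inc_finitely_generated_def by blast
  obtain N where N: "\<And>n. N \<le> n \<Longrightarrow> A n = limit A \<inter> R n"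
    using assms(1) unfolding eventually_saturated_def eventually_sequentially by blast
  obtain k where k: "1 \<le> k" "G \<subseteq> A k" using finite_subset_stage[OF G(1,2)] .
  \<comment> \<open>From \<open>k\<close> on, \<open>R m\<close> contains all generators, as the
    factorization requires; from \<open>N\<close> on, saturation holds.\<close>
  define r where "r = max k N"
  have r: "1 \<le> r" "k \<le> r" "N \<le> r" using k(1) by (auto simp: r_def)
  let ?O = "\<lambda>n. orbit act Inc G \<inter> R n"
  have orb: "orbit act Inc G \<subseteq> limit A" using G(2) by (rule orbit_subset_limit)
  then have orbR: "orbit act Inc G \<subseteq> limit R" using limit_A_subset by blast
  \<comment> \<open>Saturation turns \<open>A n\<close> into
    \<open>cl_inf (orbit act Inc G) \<inter> R n\<close>, and consistency brings the closure down to
    stage \<open>n\<close>.\<close>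
  have A_eq: "A n = cl n (?O n)" if "r \<le> n" for n
    using N[of n] G(3) cl_Int_R[of n, OF _ orbR] r that by simp
  have O_subset: "?O n \<subseteq> A n" if "r \<le> n" for n
    using N[of n] orb r that by auto
  have "stabilizes act cl A"
    unfolding stabilizes_def
  proof (intro exI[of _ r] conjI allI impI)
    fix m n assume mn: "r \<le> m" "m \<le> n"
    then have le: "1 \<le> m" "1 \<le> n" "r \<le> n" using r(1) by auto
    have "G \<subseteq> R m"
      using k mn(1) r(2) A_mono[of k m] A_subset_R[of m] le(1) by auto
    then have "?O n \<subseteq> orbit act (Inc_mn m n) (?O m)"
      using le(1) mn(2) by (intro orbit_Int_R_subset)
    also have "\<dots> \<subseteq> orbit act (Inc_mn m n) (A m)"
      using O_subset[OF mn(1)] by (rule orbit_mono)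
    finally have "cl n (?O n) \<subseteq> cl n (orbit act (Inc_mn m n) (A m))"
      using le by (intro cl_mono orbit_subset_R A_subset_R)
    then have "A n \<subseteq> cl n (orbit act (Inc_mn m n) (A m))"
      using A_eq[OF le(3)] by simp
    then show "cl n (orbit act (Inc_mn m n) (A m)) = A n"
      using cl_orbit_subset[OF le(1) mn(2)] by blast
  qed (rule r(1))
  \<comment> \<open>The generating set is the truncated orbit itself, finite because
    \<open>G\<close> is.\<close>
  moreover have "\<exists>H. finite H \<and> H \<subseteq> A n \<and> A n = cl n H" if "r \<le> n" for n
    using A_eq[OF that] O_subset[OF that] finite_orbit_Int_R[OF G(1), of n] that r(1)
    by (intro exI[of _ "?O n"]) auto
  then have "eventually_finitely_generated cl A"
    unfolding eventually_finitely_generated_def eventually_sequentially by blast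
  ultimately show ?thesis ..
qed

end

section \<open>Push-forwards of finitely supported functions\<close>

text \<open>The additive extension of a map of indices, adding values where indices collide. Vectors
  use it with \<open>\<pi>\<close>; polynomials use it twice, on exponents and then on
  monomials.\<close>

definition push :: "('a \<Rightarrow> 'b) \<Rightarrow> ('a \<Rightarrow>\<^sub>0 'c) \<Rightarrow> ('b \<Rightarrow>\<^sub>0 'c::comm_monoid_add)" where
  "push f v = (\<Sum>k \<in> Poly_Mapping.keys v. Poly_Mapping.single (f k) (Poly_Mapping.lookup v k))"

lemma push_cong: "(\<And>k. k \<in> Poly_Mapping.keys v \<Longrightarrow> f k = g k) \<Longrightarrow> push f v = push g v"
  by (simp add: push_def)

lemma lookup_push:
  assumes "inj f"
  shows "Poly_Mapping.lookup (push f v) (f k) = Poly_Mapping.lookup v k"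
proof -
  have "Poly_Mapping.lookup (push f v) (f k) =
      (\<Sum>l \<in> Poly_Mapping.keys v. if l = k then Poly_Mapping.lookup v l else 0)"
    using assms by (simp add: push_def lookup_sum lookup_single when_def inj_eq)
  then show ?thesis by (simp add: in_keys_iff)
qed

text \<open>An injective map merges no two keys, so no value can cancel.\<close>

lemma keys_push:
  assumes "inj f"
  shows "Poly_Mapping.keys (push f v) = f ` Poly_Mapping.keys v"
proof
  show "Poly_Mapping.keys (push f v) \<subseteq> f ` Poly_Mapping.keys v"
  proof
    fix l assume "l \<in> Poly_Mapping.keys (push f v)"
    then have "(\<Sum>k \<in> Poly_Mapping.keys v.
        Poly_Mapping.lookup (Poly_Mapping.single (f k) (Poly_Mapping.lookup v k)) l) \<noteq> 0"
      by (simp add: push_def lookup_sum in_keys_iff)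
    then obtain k where "k \<in> Poly_Mapping.keys v"
      "Poly_Mapping.lookup (Poly_Mapping.single (f k) (Poly_Mapping.lookup v k)) l \<noteq> 0"
      by (rule sum.not_neutral_contains_not_neutral)
    then show "l \<in> f ` Poly_Mapping.keys v" by (auto simp: lookup_single when_def split: if_splits)
  qed
  show "f ` Poly_Mapping.keys v \<subseteq> Poly_Mapping.keys (push f v)"
    using assms by (auto simp: in_keys_iff lookup_push)
qed

lemma push_push:
  assumes "inj f"
  shows "push g (push f v) = push (g \<circ> f) v"
proof -
  have "push g (push f v) = (\<Sum>l \<in> f ` Poly_Mapping.keys v.
      Poly_Mapping.single (g l) (Poly_Mapping.lookup (push f v) l))"
    by (simp add: push_def[of g] keys_push[OF assms])
  also have "\<dots> = push (g \<circ> f) v"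
    using assms by (subst sum.reindex) (auto simp: push_def[of "g \<circ> f"] lookup_push intro: inj_on_subset)
  finally show ?thesis .
qed

text \<open>This permits iteration: the map on monomials is itself a push-forward, and its
  injectivity makes the preceding lemmas available for polynomials.\<close>

lemma inj_push:
  assumes "inj f"
  shows "inj (push f :: ('a \<Rightarrow>\<^sub>0 'c::comm_monoid_add) \<Rightarrow> _)"
proof (rule injI)
  fix v w :: "'a \<Rightarrow>\<^sub>0 'c" assume "push f v = push f w"
  then have "Poly_Mapping.lookup v k = Poly_Mapping.lookup w k" for k
    using lookup_push[OF assms, of v k] lookup_push[OF assms, of w k] by simp
  then show "v = w" by (rule poly_mapping_eqI)
qed

section \<open>The two ambient chains\<close>

lemma real_act_eq_push: "real_act \<pi> = push \<pi>"
  by (simp add: fun_eq_iff real_act_def push_def)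

lemma ambient_chain_real:
  assumes R: "real_chain R"
  shows "ambient_chain R real_act Poly_Mapping.keys"
proof
  show "R m \<subseteq> R n" if "1 \<le> m" "m \<le> n" for m n
    using R that unfolding real_chain_def by blast
  show "real_act \<sigma> (real_act \<tau> x) = real_act (\<sigma> \<circ> \<tau>) x" if "\<sigma> \<in> Inc" "\<tau> \<in> Inc" for \<sigma> \<tau> x
    using that by (simp add: real_act_eq_push push_push Inc_inj)
  show cong: "real_act \<pi> x = real_act \<rho> x"
    if "\<And>j. j \<in> Poly_Mapping.keys x \<Longrightarrow> \<pi> j = \<rho> j" for x \<pi> \<rho>
    unfolding real_act_eq_push using that by (rule push_cong)
  show "Poly_Mapping.keys (real_act \<pi> x) = \<pi> ` Poly_Mapping.keys x" if "\<pi> \<in> Inc" for \<pi> x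
    using that by (simp add: real_act_eq_push keys_push Inc_inj)
  show supp: "Poly_Mapping.keys x \<subseteq> {1..n}" if "1 \<le> n" "x \<in> R n" for n x
  proof -
    have "R n \<subseteq> real_space n" using R that(1) unfolding real_chain_def by blast
    then show ?thesis using that(2) by (auto simp: real_space_def)
  qed
  show "real_act \<pi> x \<in> R n"
    if x: "1 \<le> n" "x \<in> R n" "\<pi> \<in> Inc" "\<pi> ` Poly_Mapping.keys x \<subseteq> {1..n}" for n x \<pi>
  proof -
    \<comment> \<open>\<open>\<pi>\<close> may move points of \<open>{1..n}\<close> outside the
      interval, so the chain axiom cannot be applied to it directly. It is replaced by an injection
      \<open>\<rho>\<close> of \<open>{1..n}\<close> into itself that agrees with it on the support
      and need not be increasing.\<close>
    have "inj_on \<pi> (Poly_Mapping.keys x)"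
      using Inc_inj[OF x(3)] by (rule inj_on_subset) simp
    then obtain \<rho> where \<rho>: "inj_on \<rho> {1..n}" "\<rho> ` {1..n} \<subseteq> {1..n}"
      "\<And>j. j \<in> Poly_Mapping.keys x \<Longrightarrow> \<rho> j = \<pi> j"
      using inj_on_extend_subset[of "{1..n}" "Poly_Mapping.keys x" \<pi>, OF _ supp[OF x(1,2)] _ x(4)]
      by blast
    then have "real_act \<rho> ` R n \<subseteq> R n" using R x(1) unfolding real_chain_def by blast
    moreover have "real_act \<pi> x = real_act \<rho> x" using \<rho>(3) by (intro cong) simp
    ultimately show ?thesis using x(2) by auto
  qed
qed simp

section \<open>Polynomials: renaming variables as a push-forward\<close>

definition rename_vars :: "(nat \<Rightarrow> nat) \<Rightarrow> (nat \<times> nat \<Rightarrow>\<^sub>0 nat) \<Rightarrow> (nat \<times> nat \<Rightarrow>\<^sub>0 nat)" where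
  "rename_vars \<pi> = push (map_prod id \<pi>)"

lemma var_poly_power: "(var_poly v :: 'k::comm_ring_1 mpoly) ^ e = Poly_Mapping.single (Poly_Mapping.single v e) 1"
  by (induction e) (simp_all add: var_poly_def mult_single single_add[symmetric] add.commute)

lemma prod_single_one:
  "finite I \<Longrightarrow> (\<Prod>i\<in>I. Poly_Mapping.single (f i) 1) =
     (Poly_Mapping.single (\<Sum>i\<in>I. f i) 1 :: 'b::comm_monoid_add \<Rightarrow>\<^sub>0 'k::comm_semiring_1)"
  by (induction I rule: finite_induct) (simp_all add: mult_single)

text \<open>The image of a monomial is again a monomial with coefficient 1, so the algebra
  homomorphism only relabels monomials and keeps coefficients, adding those that meet.\<close>

lemma poly_act_eq_push: "poly_act \<pi> = (push (rename_vars \<pi>) :: 'k::comm_ring_1 mpoly \<Rightarrow> _)"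
proof
  fix p :: "'k mpoly"
  have "(\<Prod>(i, j) \<in> Poly_Mapping.keys t. var_poly (i, \<pi> j) ^ Poly_Mapping.lookup t (i, j)) =
      (Poly_Mapping.single (rename_vars \<pi> t) 1 :: 'k mpoly)" for t
    by (simp add: var_poly_power case_prod_beta prod_single_one rename_vars_def push_def map_prod_def)
  then show "poly_act \<pi> p = push (rename_vars \<pi>) p"
    by (simp add: poly_act_def push_def const_poly_def mult_single)
qed

lemma inj_map_prod_Inc: "\<pi> \<in> Inc \<Longrightarrow> inj (map_prod id \<pi> :: nat \<times> nat \<Rightarrow> _)"
  by (simp add: Inc_inj prod.inj_map)

lemma inj_rename_vars: "\<pi> \<in> Inc \<Longrightarrow> inj (rename_vars \<pi>)"
  by (simp add: rename_vars_def inj_push inj_map_prod_Inc)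

text \<open>Injectivity enters on both levels: distinct monomials stay distinct, and so do the
  variables inside each of them, so nothing cancels.\<close>

lemma vars_poly_act:
  "\<pi> \<in> Inc \<Longrightarrow> vars (poly_act \<pi> p) = map_prod id \<pi> ` vars (p :: 'k::comm_ring_1 mpoly)"
  by (simp add: vars_def poly_act_eq_push keys_push inj_rename_vars rename_vars_def
      inj_push inj_map_prod_Inc image_UN)

lemma ambient_chain_poly:
  "ambient_chain (poly_chain c :: nat \<Rightarrow> 'k::comm_ring_1 mpoly set) poly_act (\<lambda>p. snd ` vars p)"
proof
  show "poly_chain c m \<subseteq> (poly_chain c n :: 'k mpoly set)" if "1 \<le> m" "m \<le> n" for m n
    using that by (fastforce simp: poly_chain_def polys_in_def)
  show "poly_act \<sigma> (poly_act \<tau> x) = poly_act (\<sigma> \<circ> \<tau>) x"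
    if "\<sigma> \<in> Inc" "\<tau> \<in> Inc" for \<sigma> \<tau> and x :: "'k mpoly"
  proof -
    \<comment> \<open>Functoriality is proved on monomials first; a second push-forward lifts it to
      polynomials.\<close>
    have "rename_vars \<sigma> \<circ> rename_vars \<tau> = rename_vars (\<sigma> \<circ> \<tau>)"
      using that by (simp add: fun_eq_iff rename_vars_def push_push inj_map_prod_Inc map_prod.comp)
    then show ?thesis using that by (simp add: poly_act_eq_push push_push inj_rename_vars)
  qed
  show "poly_act \<pi> x = poly_act \<rho> x"
    if "\<And>j. j \<in> snd ` vars x \<Longrightarrow> \<pi> j = \<rho> j" for x :: "'k mpoly" and \<pi> \<rho>
    unfolding poly_act_eq_push rename_vars_def
    using that by (intro push_cong) (force simp: vars_def map_prod_def)
  show "snd ` vars (poly_act \<pi> x) = \<pi> ` snd ` vars x" if "\<pi> \<in> Inc" for \<pi> and x :: "'k mpoly"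
    using that by (simp add: vars_poly_act image_comp)
  show "finite (snd ` vars x)" for x :: "'k mpoly"
    by (simp add: vars_def)
  show "snd ` vars x \<subseteq> {1..n}" if "x \<in> poly_chain c n" for n and x :: "'k mpoly"
    using that by (auto simp: poly_chain_def polys_in_def)
  show "poly_act \<pi> x \<in> poly_chain c n"
    if "x \<in> poly_chain c n" "\<pi> \<in> Inc" "\<pi> ` snd ` vars x \<subseteq> {1..n}" for n \<pi> and x :: "'k mpoly"
    using that by (fastforce simp: poly_chain_def polys_in_def vars_poly_act)
qed

theorem theorem4p11:
  shows
   "(\<forall>(c::nat) (R :: nat \<Rightarrow> 'k::field mpoly set) cl cl_inf A.
       1 \<le> c \<and> R = poly_chain c \<and>
       (\<forall>n\<ge>1. closure_operation (R n) (cl n)) \<and>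
       closure_operation (limit R) cl_inf \<and>
       consistent R cl cl_inf \<and>
       Inc_compatible R poly_act cl \<and>
       is_chain R A \<and>
       Inc_invariant poly_act cl A \<and>
       closed_chain cl A \<and>
       cl_inf (limit A) = limit A
     \<longrightarrow>
       (stabilizes poly_act cl A \<and> eventually_finitely_generated cl A \<longrightarrow>
          Inc_finitely_generated poly_act cl_inf (limit A)) \<and>
       (eventually_saturated R A \<longrightarrow>
          (stabilizes poly_act cl A \<and> eventually_finitely_generated cl A \<longleftrightarrow>
           Inc_finitely_generated poly_act cl_inf (limit A))))
    \<and>
    (\<forall>(R :: nat \<Rightarrow> (nat \<Rightarrow>\<^sub>0 real) set) cl cl_inf A.
       real_chain R \<and>
       (\<forall>n\<ge>1. closure_operation (R n) (cl n)) \<and>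
       closure_operation (limit R) cl_inf \<and>
       consistent R cl cl_inf \<and>
       Inc_compatible R real_act cl \<and>
       is_chain R A \<and>
       Inc_invariant real_act cl A \<and>
       closed_chain cl A \<and>
       cl_inf (limit A) = limit A
     \<longrightarrow>
       (stabilizes real_act cl A \<and> eventually_finitely_generated cl A \<longrightarrow>
          Inc_finitely_generated real_act cl_inf (limit A)) \<and>
       (eventually_saturated R A \<longrightarrow>
          (stabilizes real_act cl A \<and> eventually_finitely_generated cl A \<longleftrightarrow>
           Inc_finitely_generated real_act cl_inf (limit A))))"
proof (intro conjI[of "All _" "All _"] allI impI, goal_cases)
  case (1 c R cl cl_inf A)
  then interpret ambient_chain R poly_act "\<lambda>p. snd ` vars p"
    using ambient_chain_poly by blast
  interpret invariant_closed_chain R poly_act "\<lambda>p. snd ` vars p" cl cl_inf A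
    using 1 by unfold_locales blast+
  show ?case
    \<comment> \<open>The first lemma gives (a) implies (b) without saturation; saturation enters
      only through the second, the converse.\<close>
    using Inc_finitely_generated_if_stable stable_if_Inc_finitely_generated by blast
next
  case (2 R cl cl_inf A)
  then interpret ambient_chain R real_act Poly_Mapping.keys
    using ambient_chain_real by blast
  interpret invariant_closed_chain R real_act Poly_Mapping.keys cl cl_inf A
    using 2 by unfold_locales blast+
  show ?case
    using Inc_finitely_generated_if_stable stable_if_Inc_finitely_generated by blast
qed

end
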